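(* Let $p\ge3$ be an integer and $q=p-1$. Let $\Phi_q(X,Y)=\sum_{m,n\ge0}c^{(q)}_{m,n}X^mY^n$ and $\mathcal S_p(X,Y)=\sum_{m,n\ge0}s^{(p)}_{m,n}X^mY^n$ be the formal power series with $$c^{(q)}_{m,n}=\frac{\prod_{j=0}^{q}\left(\frac{q+j}{q}\right)_{m+n}}{\prod_{j=0}^{q}\left(\frac{q+j}{q}\right)_{m}\,(2)_n\prod_{j=2}^{q+1}\left(\frac{j}{q}\right)_n},\qquad s^{(p)}_{m,n}=\frac{\prod_{j=0}^{q}\left(1+\frac jq\right)_{m+n}}{\prod_{j=0}^{q}\left(1+\frac jq\right)_{m}\prod_{j=0}^{q}\left(1+\frac jq\right)_{n}}.$$ Let $\theta_Y=Y\partial_Y$. Then $$\Phi_q(X,Y)=\mathcal D_p\,\mathcal S_p(X,Y),\qquad \mathcal D_p=\prod_{j=2}^{p-2}\frac{(p-1)\theta_Y+j}{j},$$ and the differential operator $\mathcal D_p$ has order $p-3$.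
   Context: $(a)_n=a(a+1)\cdots(a+n-1)$, $(a)_0=1$, is the Pochhammer symbol. An empty product equals $1$ (so $\mathcal D_3=1$). *)

theory Defs
  imports "HOL-Computational_Algebra.Formal_Power_Series"
begin

text \<open>Bivariate formal power series in \<open>X\<close>, \<open>Y\<close> over \<open>'a\<close> are rendered as \<open>'a fps fps\<close>,
  i.e. \<open>K[[X]][[Y]]\<close>: the outer variable is \<open>Y\<close>, the inner one is \<open>X\<close>, and
  \<open>fps_nth (fps_nth F n) m\<close> is the coefficient of \<open>X^m Y^n\<close>.\<close>

definition fps2 :: "(nat \<Rightarrow> nat \<Rightarrow> 'a) \<Rightarrow> 'a fps fps" where
  "fps2 c = Abs_fps (\<lambda>n. Abs_fps (\<lambda>m. c m n))"

definition deriv_X :: "'a::comm_ring_1 fps fps \<Rightarrow> 'a fps fps" where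
  "deriv_X F = Abs_fps (\<lambda>n. fps_deriv (fps_nth F n))"

definition deriv_Y :: "'a::comm_ring_1 fps fps \<Rightarrow> 'a fps fps" where
  "deriv_Y F = fps_deriv F"

definition theta_Y :: "'a::comm_ring_1 fps fps \<Rightarrow> 'a fps fps" where
  "theta_Y F = fps_X * deriv_Y F"

definition c_coeff :: "nat \<Rightarrow> nat \<Rightarrow> nat \<Rightarrow> 'a::field_char_0" where
  "c_coeff q m n =
     (\<Prod>j=0..q. pochhammer (of_nat (q + j) / of_nat q) (m + n)) /
     ((\<Prod>j=0..q. pochhammer (of_nat (q + j) / of_nat q) m) * pochhammer 2 n *
      (\<Prod>j=2..q+1. pochhammer (of_nat j / of_nat q) n))"

definition s_coeff :: "nat \<Rightarrow> nat \<Rightarrow> nat \<Rightarrow> 'a::field_char_0" where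
  "s_coeff p m n = (let q = p - 1 in
     (\<Prod>j=0..q. pochhammer (1 + of_nat j / of_nat q) (m + n)) /
     ((\<Prod>j=0..q. pochhammer (1 + of_nat j / of_nat q) m) *
      (\<Prod>j=0..q. pochhammer (1 + of_nat j / of_nat q) n)))"

definition Phi :: "nat \<Rightarrow> 'a::field_char_0 fps fps" where
  "Phi q = fps2 (c_coeff q)"

definition S_series :: "nat \<Rightarrow> 'a::field_char_0 fps fps" where
  "S_series p = fps2 (s_coeff p)"

definition D_factor :: "nat \<Rightarrow> nat \<Rightarrow> 'a::field_char_0 fps fps \<Rightarrow> 'a fps fps" where
  "D_factor p j F =
     fps_const (fps_const (1 / of_nat j)) * (of_nat (p - 1) * theta_Y F + of_nat j * F)"

text \<open>The product of operators is composition, over \<open>j = 2, \<dots>, p - 2\<close>; the factors commute,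
  so their order is immaterial.\<close>

definition D_op :: "nat \<Rightarrow> 'a::field_char_0 fps fps \<Rightarrow> 'a fps fps" where
  "D_op p = foldr (\<lambda>j P. D_factor p j \<circ> P) [2..<p - 1] id"

text \<open>\<open>P\<close> is a linear partial differential operator \<open>\<Sum> a i l * \<partial>_X^i \<partial>_Y^l\<close> (sum over
  \<open>i + l \<le> d\<close>) of order exactly \<open>d\<close>: some coefficient with \<open>i + l = d\<close> is nonzero. In
  characteristic \<open>0\<close> the coefficients are determined by the action of \<open>P\<close> on power series, so
  \<open>d\<close> is unique.\<close>

definition has_diff_order :: "('a::field_char_0 fps fps \<Rightarrow> 'a fps fps) \<Rightarrow> nat \<Rightarrow> bool" where
  "has_diff_order P d \<longleftrightarrow>
     (\<exists>a :: nat \<Rightarrow> nat \<Rightarrow> 'a fps fps.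
        (\<forall>F. P F = (\<Sum>(i, l) \<in> {(i, l). i + l \<le> d}. a i l * (deriv_X ^^ i) ((deriv_Y ^^ l) F))) \<and>
        (\<exists>i l. i + l = d \<and> a i l \<noteq> 0))"

end

theory Submission
  imports Defs
begin

text \<open>The operator \<open>\<theta>\<^sub>Y\<close> acts on the coefficient of \<open>X\<^sup>m Y\<^sup>n\<close> as multiplication by \<open>n\<close>, so the
  identity reduces to \<open>c m n = s m n * (\<Prod>j=2..p-2. (q n + j) / j)\<close>. After cancelling the parameters
  \<open>1\<close>, \<open>1 + 1/q\<close> and \<open>2\<close>, which occur in both denominators, this is the contiguity relation
  \<open>(a + 1)\<^sub>n = (a)\<^sub>n (a + n) / a\<close> for \<open>a = j/q\<close>. The order is found by pushing \<open>\<partial>\<^sub>Y\<close> to the right: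
  every factor multiplies the leading coefficient by \<open>q Y / j\<close>, which is nonzero.\<close>

lemma fps_nth_D_factor:
  "fps_nth (fps_nth (D_factor p j F) n) m =
     (of_nat (p - 1) * of_nat n + of_nat j) / of_nat j * fps_nth (fps_nth F n) m"
proof -
  have of_nat_nth: "fps_nth (fps_nth (of_nat k * G) n) m = of_nat k * fps_nth (fps_nth G n) m"
    for k :: nat and G :: "'a fps fps"
    by (simp flip: fps_of_nat)
  have theta: "fps_nth (fps_nth (theta_Y F) n) m = of_nat n * fps_nth (fps_nth F n) m"
    by (cases n) (auto simp: theta_Y_def deriv_Y_def simp flip: fps_of_nat)
  show ?thesis
    unfolding D_factor_def fps_mult_left_const_nth fps_add_nth of_nat_nth theta
    by (simp add: algebra_simps add_divide_distrib)
qed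

lemma fps_nth_foldr_D_factor:
  "fps_nth (fps_nth (foldr (\<lambda>j P. D_factor p j \<circ> P) js id F) n) m =
     (\<Prod>j\<leftarrow>js. (of_nat (p - 1) * of_nat n + of_nat j) / of_nat j) * fps_nth (fps_nth F n) m"
  by (induction js) (simp_all add: fps_nth_D_factor)

lemma fps_nth_D_op:
  "fps_nth (fps_nth (D_op p F) n) m =
     (\<Prod>j\<in>{2..<p - 1}. (of_nat (p - 1) * of_nat n + of_nat j) / of_nat j) * fps_nth (fps_nth F n) m"
  unfolding D_op_def fps_nth_foldr_D_factor by (simp flip: prod.distinct_set_conv_list)

text \<open>Expand \<open>pochhammer a (Suc n)\<close> in two ways: splitting off the first factor
  leaves the shifted symbol, splitting off the last one leaves \<open>a + n\<close>.\<close>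

lemma pochhammer_add_1_left:
  fixes a :: "'a::field_char_0"
  assumes "a \<noteq> 0"
  shows "pochhammer (1 + a) n = pochhammer a n * ((a + of_nat n) / a)"
proof -
  have "a * pochhammer (1 + a) n = pochhammer a n * (a + of_nat n)"
    using pochhammer_rec[of a n] pochhammer_Suc[of a n] by (simp add: add.commute)
  with assms show ?thesis
    by (simp add: field_simps)
qed

text \<open>Only the parameters with 2 \<le> j < q have to be lowered by 1, at the cost of (q n + j)
  / j each; those for j = 0, 1, q already occur on the right.\<close>

lemma prod_pochhammer_shift:
  fixes q n :: nat
  assumes "q \<ge> 2"
  shows "(\<Prod>j=0..q. pochhammer (1 + of_nat j / of_nat q) n :: 'a::field_char_0) =
    pochhammer 2 n * (\<Prod>j=2..q+1. pochhammer (of_nat j / of_nat q) n) *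
    (\<Prod>j\<in>{2..<q}. (of_nat q * of_nat n + of_nat j) / of_nat j)"
proof -
  define f :: "nat \<Rightarrow> 'a" where "f j = pochhammer (of_nat j / of_nat q) n" for j
  define r :: "nat \<Rightarrow> 'a" where "r j = (of_nat q * of_nat n + of_nat j) / of_nat j" for j
  have q0: "(of_nat q :: 'a) \<noteq> 0"
    using assms by simp
  have shift: "pochhammer (1 + of_nat j / of_nat q) n = f j * r j" if "j > 0" for j
  proof -
    have "(of_nat j / of_nat q + of_nat n) / (of_nat j / of_nat q) = r j"
      using that q0 by (simp add: r_def field_simps)
    with that q0 show ?thesis
      by (simp add: pochhammer_add_1_left f_def)
  qed
  have "(\<Prod>j=0..q. pochhammer (1 + of_nat j / of_nat q) n :: 'a) =
      (\<Prod>j\<in>insert 0 (insert 1 (insert q {2..<q})). pochhammer (1 + of_nat j / of_nat q) n)"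
    using assms by (intro prod.cong) auto
  \<comment> \<open>The indices 0, 1, q are distinct as q \<ge> 2; their parameters are q/q, (q +
    1)/q and 2.\<close>
  also have "\<dots> = f q * f (q + 1) * pochhammer 2 n * (\<Prod>j\<in>{2..<q}. f j * r j)"
    using assms q0 by (simp add: f_def shift add_divide_distrib add.commute)
  also have "\<dots> = pochhammer 2 n * (\<Prod>j\<in>insert q (insert (q + 1) {2..<q}). f j) * (\<Prod>j\<in>{2..<q}. r j)"
    by (simp add: prod.distrib)
  also have "insert q (insert (q + 1) {2..<q}) = {2..q+1}"
    using assms by auto
  finally show ?thesis
    by (simp only: f_def r_def)
qed

text \<open>The numerators and the m-parts of the denominators agree, so only the n-parts matter;
  they differ by the shift product, which is nonzero and cancels.\<close>

lemma c_coeff_eq_s_coeff: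
  fixes q m n :: nat
  assumes "q \<ge> 2"
  shows "(c_coeff q m n :: 'a::field_char_0) =
    (\<Prod>j\<in>{2..<q}. (of_nat q * of_nat n + of_nat j) / of_nat j) * s_coeff (q + 1) m n"
proof -
  have quot: "of_nat (q + j) / of_nat q = (1 + of_nat j / of_nat q :: 'a)" for j
    using assms by (simp add: add_divide_distrib)
  \<comment> \<open>This is the image of a positive natural number, hence nonzero in characteristic
    0.\<close>
  have "(of_nat q * of_nat n + of_nat j :: 'a) \<noteq> 0" if "j \<in> {2..<q}" for j
    using that by (metis atLeastLessThan_iff add_is_0 not_numeral_le_zero of_nat_0_eq_iff of_nat_add of_nat_mult)
  then have "(\<Prod>j\<in>{2..<q}. (of_nat q * of_nat n + of_nat j) / of_nat j :: 'a) \<noteq> 0"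
    by auto
  then show ?thesis
    unfolding c_coeff_def s_coeff_def Let_def quot add_diff_cancel_right' prod_pochhammer_shift[OF assms]
    by (simp add: mult.assoc)
qed

text \<open>By the Leibniz rule, \<partial>_Y sends \<open>b l\<close> times the l-th derivative to
  a term of order l and one of order l + 1. Collecting by order gives the recursion for the
  coefficients of a composition.\<close>

lemma D_factor_deriv_Y_sum:
  fixes b :: "nat \<Rightarrow> 'a::field_char_0 fps fps"
  defines "e \<equiv> \<lambda>j. fps_const (fps_const (1 / of_nat j)) :: 'a fps fps"
  assumes "b (Suc k) = 0"
  shows "D_factor p j (\<Sum>l\<le>k. b l * (deriv_Y ^^ l) F) =
    (\<Sum>l\<le>Suc k. e j * (of_nat (p - 1) * fps_X * (deriv_Y (b l) + (if l = 0 then 0 else b (l - 1)))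
       + of_nat j * b l) * (deriv_Y ^^ l) F)"
proof -
  let ?D = "\<lambda>l. (deriv_Y ^^ l) F"
  have "deriv_Y (\<Sum>l\<le>k. b l * ?D l) = (\<Sum>l\<le>k. deriv_Y (b l) * ?D l) + (\<Sum>l\<le>k. b l * ?D (Suc l))"
    by (simp add: deriv_Y_def fps_deriv_sum sum.distrib add.commute)
  \<comment> \<open>The case distinction is needed because \<open>0 - 1 = 0\<close> on naturals
    would bring in \<open>b 0\<close>.\<close>
  also have "(\<Sum>l\<le>k. b l * ?D (Suc l)) = (\<Sum>l\<le>Suc k. (if l = 0 then 0 else b (l - 1)) * ?D l)"
    by (subst sum.atMost_Suc_shift) simp
  also have "(\<Sum>l\<le>k. deriv_Y (b l) * ?D l) = (\<Sum>l\<le>Suc k. deriv_Y (b l) * ?D l)"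
    using assms by (simp add: deriv_Y_def)
  finally have deriv: "deriv_Y (\<Sum>l\<le>k. b l * ?D l) =
      (\<Sum>l\<le>Suc k. (deriv_Y (b l) + (if l = 0 then 0 else b (l - 1))) * ?D l)"
    by (simp only: sum.distrib distrib_right)
  have same: "(\<Sum>l\<le>k. b l * ?D l) = (\<Sum>l\<le>Suc k. b l * ?D l)"
    using assms by simp
  have "D_factor p j (\<Sum>l\<le>k. b l * ?D l) =
      e j * (of_nat (p - 1) * (fps_X * (\<Sum>l\<le>Suc k. (deriv_Y (b l) + (if l = 0 then 0 else b (l - 1))) * ?D l))
        + of_nat j * (\<Sum>l\<le>Suc k. b l * ?D l))"
    unfolding D_factor_def theta_Y_def deriv e_def by (simp only: same)
  also have "\<dots> = (\<Sum>l\<le>Suc k. e j * (of_nat (p - 1) * fps_X *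
      (deriv_Y (b l) + (if l = 0 then 0 else b (l - 1))) + of_nat j * b l) * ?D l)"
    unfolding sum_distrib_left sum.distrib[symmetric]
    by (intro sum.cong refl) (simp only: distrib_left distrib_right mult.assoc)
  finally show ?thesis .
qed

text \<open>Induction over the list of factors. Vanishing of \<open>b\<close> beyond the length is
  carried along so that the Leibniz expansion applies at each step.\<close>

lemma foldr_D_factor_deriv_Y_sum:
  assumes "p > 1" and "\<forall>j\<in>set js. j > 0"
  shows "\<exists>b :: nat \<Rightarrow> 'a::field_char_0 fps fps.
    (\<forall>F. foldr (\<lambda>j P. D_factor p j \<circ> P) js id F = (\<Sum>l\<le>length js. b l * (deriv_Y ^^ l) F)) \<and>
    b (length js) \<noteq> 0 \<and> (\<forall>l>length js. b l = 0)"
  using assms(2)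
proof (induction js)
  case Nil
  show ?case
    by (rule exI[of _ "\<lambda>l. if l = 0 then 1 else 0"]) simp
next
  case (Cons j js)
  define k where "k = length js"
  have len: "length (j # js) = Suc k"
    by (simp add: k_def)
  have "\<forall>j\<in>set js. j > 0"
    using Cons.prems by simp
  from Cons.IH[OF this, folded k_def] obtain b :: "nat \<Rightarrow> 'a fps fps" where
    b: "\<And>F. foldr (\<lambda>j P. D_factor p j \<circ> P) js id F = (\<Sum>l\<le>k. b l * (deriv_Y ^^ l) F)"
    and top: "b k \<noteq> 0" and vanish: "\<And>l. l > k \<Longrightarrow> b l = 0"
    by blast
  define b' where "b' l = fps_const (fps_const (1 / of_nat j)) *
    (of_nat (p - 1) * fps_X * (deriv_Y (b l) + (if l = 0 then 0 else b (l - 1))) + of_nat j * b l)" for l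
  have "foldr (\<lambda>j P. D_factor p j \<circ> P) (j # js) id F = (\<Sum>l\<le>Suc k. b' l * (deriv_Y ^^ l) F)" for F
    by (simp only: foldr.simps o_apply b D_factor_deriv_Y_sum[of b k, OF vanish[OF lessI]] b'_def)
  moreover have "b' (Suc k) \<noteq> 0"
  proof -
    \<comment> \<open>At the top index \<open>b (Suc k)\<close> and its derivative vanish, so only
      the shifted term with \<open>b k\<close> survives. It is nonzero because the power series ring
      has no zero divisors.\<close>
    have "b' (Suc k) = fps_const (fps_const (1 / of_nat j)) * (of_nat (p - 1) * fps_X * b k)"
      by (simp add: b'_def vanish deriv_Y_def)
    moreover have "fps_const (fps_const (1 / of_nat j)) \<noteq> (0 :: 'a fps fps)"
      using Cons.prems by (simp add: fps_const_eq_0_iff)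
    moreover have "of_nat (p - 1) \<noteq> (0 :: 'a fps fps)"
      using assms(1) by (simp only: of_nat_eq_0_iff)
    ultimately show ?thesis
      using top by (simp only: mult_eq_0_iff fps_X_neq_zero simp_thms)
  qed
  moreover have "b' l = 0" if "l > Suc k" for l
    using that by (simp add: b'_def vanish deriv_Y_def)
  ultimately show ?case
    unfolding len by blast
qed

text \<open>An operator in \<partial>_Y alone is a partial differential operator whose coefficients
  with i > 0 are zero; the pair (0, d) witnesses the order.\<close>

lemma has_diff_order_deriv_Y_sum:
  assumes "\<And>F. P F = (\<Sum>l\<le>d. b l * (deriv_Y ^^ l) F)" and "b d \<noteq> 0"
  shows "has_diff_order P d"
  unfolding has_diff_order_def
proof (intro exI[of _ "\<lambda>i l. if i = 0 then b l else 0"] conjI allI)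
  fix F
  have fin: "finite {(i, l). i + l \<le> d}"
    by (rule finite_subset[of _ "{..d} \<times> {..d}"]) auto
  have "P F = (\<Sum>(i, l)\<in>{0} \<times> {..d}. (if i = 0 then b l else 0) * (deriv_X ^^ i) ((deriv_Y ^^ l) F))"
    by (simp add: assms(1) flip: sum.cartesian_product)
  \<comment> \<open>The column i = 0 lies inside the triangle i + l \<le> d, and all terms outside
    it are zero.\<close>
  also have "\<dots> = (\<Sum>(i, l)\<in>{(i, l). i + l \<le> d}. (if i = 0 then b l else 0) * (deriv_X ^^ i) ((deriv_Y ^^ l) F))"
    by (rule sum.mono_neutral_left[OF fin]) (auto split: if_splits)
  finally show "P F = (\<Sum>(i, l)\<in>{(i, l). i + l \<le> d}. (if i = 0 then b l else 0) * (deriv_X ^^ i) ((deriv_Y ^^ l) F))" .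
qed (use assms(2) in \<open>auto intro: exI[of _ 0]\<close>)

theorem theorem5p2:
  fixes p q :: nat
  assumes "p \<ge> 3" and "q = p - 1"
  shows "(Phi q :: 'a::field_char_0 fps fps) = D_op p (S_series p) \<and>
         has_diff_order (D_op p :: 'a fps fps \<Rightarrow> 'a fps fps) (p - 3)"
proof
  have p: "p = q + 1" and q: "q \<ge> 2"
    using assms by auto
  show "(Phi q :: 'a fps fps) = D_op p (S_series p)"
    by (intro fps_ext) (simp add: fps_nth_D_op p Phi_def S_series_def fps2_def c_coeff_eq_s_coeff[OF q])
  \<comment> \<open>Each factor raises the order by one. For p = 3 the list is empty and the
    operator is the identity, of order 0.\<close>
  have len: "length [2..<p - 1] = p - 3"
    by simp
  have "p > 1" and "\<forall>j\<in>set [2..<p - 1]. j > 0"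
    using assms(1) by auto
  from foldr_D_factor_deriv_Y_sum[OF this, where ?'a = 'a, folded D_op_def, unfolded len]
  obtain b :: "nat \<Rightarrow> 'a fps fps" where
    "\<And>F. D_op p F = (\<Sum>l\<le>p - 3. b l * (deriv_Y ^^ l) F)" and "b (p - 3) \<noteq> 0"
    by blast
  then show "has_diff_order (D_op p :: 'a fps fps \<Rightarrow> 'a fps fps) (p - 3)"
    by (rule has_diff_order_deriv_Y_sum)
qed

end
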